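(* There is a real constant $\alpha_1<2$ such that, for all sufficiently large $n$, the number of bitrades in $Q_3^n$ does not exceed $2^{\alpha_1^n}$.
   Context: $Q_3$ is a set of $3$ symbols. A one-dimensional face of $Q_3^n$ is a set of $3$ words obtained by fixing the values of all coordinates but one. A unitrade is a set $U\subset Q_3^n$ whose intersection with every one-dimensional face has cardinality $0$ or $2$. The Hamming graph on $Q_3^n$ joins two words when they differ in exactly one coordinate. A bitrade is a unitrade $U$ such that the subgraph of the Hamming graph induced by $U$ is bipartite. Bitrades are counted as subsets of $Q_3^n$ (not up to equivalence). *)

theory Defs
  imports Complex_Main "HOL-Library.FuncSet"
begin

definition words :: "'a set \<Rightarrow> nat \<Rightarrow> (nat \<Rightarrow> 'a) set" where
  "words Q n = {..<n} \<rightarrow>\<^sub>E Q"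

definition one_dim_faces :: "'a set \<Rightarrow> nat \<Rightarrow> (nat \<Rightarrow> 'a) set set" where
  "one_dim_faces Q n =
     {{v \<in> words Q n. \<forall>j<n. j \<noteq> i \<longrightarrow> v j = w j} | i w. i < n \<and> w \<in> words Q n}"

definition unitrade :: "'a set \<Rightarrow> nat \<Rightarrow> (nat \<Rightarrow> 'a) set \<Rightarrow> bool" where
  "unitrade Q n U \<longleftrightarrow>
     U \<subseteq> words Q n \<and> (\<forall>F \<in> one_dim_faces Q n. card (U \<inter> F) = 0 \<or> card (U \<inter> F) = 2)"

definition hamming_edges :: "'a set \<Rightarrow> nat \<Rightarrow> (nat \<Rightarrow> 'a) set set" where
  "hamming_edges Q n =
     {{u, v} | u v. u \<in> words Q n \<and> v \<in> words Q n \<and> card {i. i < n \<and> u i \<noteq> v i} = 1}"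

definition induced_edges :: "'v set set \<Rightarrow> 'v set \<Rightarrow> 'v set set" where
  "induced_edges E U = {e \<in> E. e \<subseteq> U}"

(* The graph with vertex set V and edge set E; a colour class may be empty. *)
definition bipartite :: "'v set \<Rightarrow> 'v set set \<Rightarrow> bool" where
  "bipartite V E \<longleftrightarrow>
     (\<exists>A B. A \<union> B = V \<and> A \<inter> B = {} \<and> (\<forall>e\<in>E. \<exists>a\<in>A. \<exists>b\<in>B. e = {a, b}))"

definition bitrade :: "'a set \<Rightarrow> nat \<Rightarrow> (nat \<Rightarrow> 'a) set \<Rightarrow> bool" where
  "bitrade Q n U \<longleftrightarrow> unitrade Q n U \<and> bipartite U (induced_edges (hamming_edges Q n) U)"

(* Since card is 0 on infinite sets, this is what makes card {U. bitrade Q n U} a genuine count. *)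
lemma finite_bitrades:
  assumes "finite Q"
  shows "finite {U. bitrade Q n U}"
proof (rule finite_subset)
  show "{U. bitrade Q n U} \<subseteq> Pow (words Q n)"
    by (auto simp: bitrade_def unitrade_def)
  show "finite (Pow (words Q n))"
    using assms by (simp add: words_def finite_PiE)
qed

end

(*
A 2-colouring of a bitrade gives a function F with values in {-1,0,1}, the bitrade as its
support and zero sum on every line.  Such functions form the n-th tensor power of the lattice
A_2, of which the two Gram-Schmidt vectors have squared norms 3/2 and 2.  Hence F is given by its
values on {p,q}^n, and the sum of all F(w)^2, which is at most 3^n, equals a sum over S of
(3/2)^n (4/3)^|S| mu_S^2 with mu_S = F(S) + a combination of values of F at proper subsets of S.
As F(S) is an integer, |mu_S| < 1/2 determines F(S) from those values.  For |S| >= n/3 the weight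
is exponentially larger than (3/2)^n, so that 1/2 <= |mu_S| for exponentially few of the 2^n sets
S only; and exponentially few S have |S| < n/3.  Recording F at those exceptional S suffices.
*)
theory Submission
  imports Defs "HOL-Real_Asymp.Real_Asymp"
begin

section \<open>Functions with zero line sums\<close>

definition zero_line_sums :: "'a set \<Rightarrow> nat \<Rightarrow> ((nat \<Rightarrow> 'a) \<Rightarrow> real) \<Rightarrow> bool" where
  "zero_line_sums Q n F \<longleftrightarrow> (\<forall>w \<in> words Q n. \<forall>i<n. (\<Sum>x\<in>Q. F (w(i := x))) = 0)"

text \<open>Indexing the points of {p,q}^n by subsets lets the recovery of values run by induction
  over inclusion; \<open>undefined\<close> from \<open>n\<close> on matches the extensional
  functions in \<open>words\<close>.\<close>

definition vertex :: "'a \<Rightarrow> 'a \<Rightarrow> nat \<Rightarrow> nat set \<Rightarrow> nat \<Rightarrow> 'a" where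
  "vertex p q n T = (\<lambda>i. if i < n then if i \<in> T then q else p else undefined)"

text \<open>The coordinate \<open>mu_S\<close> along the Gram-Schmidt vector of \<open>S\<close>, where \<open>c\<close> lists the values at the vertices.\<close>

definition gs_coeff :: "(nat set \<Rightarrow> real) \<Rightarrow> nat set \<Rightarrow> real" where
  "gs_coeff c S = (\<Sum>T\<in>Pow S. (1/2) ^ card (S - T) * c T)"

section \<open>Sums over power sets and the recursion for the coefficients\<close>

lemma sum_Pow_insert:
  fixes f :: "'b set \<Rightarrow> real"
  assumes "finite A" "a \<notin> A"
  shows "(\<Sum>S\<in>Pow (insert a A). f S) = (\<Sum>S\<in>Pow A. f S) + (\<Sum>S\<in>Pow A. f (insert a S))"
proof -
  have "inj_on (insert a) (Pow A)"
    using assms(2) by (auto simp: inj_on_def)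
  moreover have "Pow A \<inter> insert a ` Pow A = {}"
    using assms(2) by auto
  ultimately show ?thesis
    using assms(1) by (simp add: Pow_insert sum.union_disjoint sum.reindex)
qed

text \<open>Multiply out the product of \<open>x + 1\<close> over \<open>A\<close>: the term of
  \<open>S\<close> takes \<open>x\<close> from exactly the factors in \<open>S\<close>.\<close>

lemma sum_Pow_power_card:
  fixes x :: real
  assumes "finite A"
  shows "(\<Sum>S\<in>Pow A. x ^ card S) = (1 + x) ^ card A"
  using prod_add[OF assms, of "\<lambda>_. x" "\<lambda>_. 1"] by (simp add: add.commute)

lemma gs_coeff_add:
  "gs_coeff (\<lambda>T. c T + d T) S = gs_coeff c S + gs_coeff d S"
  by (simp add: gs_coeff_def sum.distrib algebra_simps)

lemma gs_coeff_scale: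
  "gs_coeff (\<lambda>T. k * c T) S = k * gs_coeff c S"
  by (simp add: gs_coeff_def sum_distrib_left algebra_simps)

lemma gs_coeff_cong:
  "(\<And>T. T \<subseteq> S \<Longrightarrow> c T = d T) \<Longrightarrow> gs_coeff c S = gs_coeff d S"
  by (auto simp: gs_coeff_def intro!: sum.cong)

text \<open>A subset without \<open>a\<close> misses one more element of the enlarged set, hence the
  factor 1/2; for a subset with \<open>a\<close> the missing elements stay the same. This is the
  Gram-Schmidt step in the single coordinate \<open>a\<close>.\<close>

lemma gs_coeff_insert:
  assumes "finite S" "a \<notin> S"
  shows "gs_coeff c (insert a S) = gs_coeff (\<lambda>T. c (insert a T)) S + gs_coeff c S / 2"
proof -
  have "gs_coeff c (insert a S)
      = (\<Sum>T\<in>Pow S. (1/2) ^ card (insert a S - T) * c T)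
      + (\<Sum>T\<in>Pow S. (1/2) ^ card (insert a S - insert a T) * c (insert a T))"
    unfolding gs_coeff_def using assms by (rule sum_Pow_insert)
  also have "(\<Sum>T\<in>Pow S. (1/2) ^ card (insert a S - T) * c T)
      = (\<Sum>T\<in>Pow S. (1/2) ^ card (S - T) * c T / 2)"
  proof (intro sum.cong refl)
    fix T assume "T \<in> Pow S"
    then have "insert a S - T = insert a (S - T)" using assms(2) by auto
    then show "(1/2) ^ card (insert a S - T) * c T = (1/2) ^ card (S - T) * c T / 2"
      using assms by simp
  qed
  also have "(\<Sum>T\<in>Pow S. (1/2) ^ card (insert a S - insert a T) * c (insert a T))
      = gs_coeff (\<lambda>T. c (insert a T)) S"
    unfolding gs_coeff_def
  proof (intro sum.cong refl)
    fix T assume "T \<in> Pow S"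
    then have "insert a S - insert a T = S - T" using assms(2) by auto
    then show "(1/2) ^ card (insert a S - insert a T) * c (insert a T)
        = (1/2) ^ card (S - T) * c (insert a T)" by simp
  qed
  finally show ?thesis by (simp add: gs_coeff_def sum_divide_distrib)
qed

section \<open>Words and slices along the last coordinate\<close>

lemma words_fun_upd:
  "w \<in> words Q n \<Longrightarrow> i < n \<Longrightarrow> a \<in> Q \<Longrightarrow> w(i := a) \<in> words Q n"
  by (auto simp: words_def PiE_iff extensional_def)

lemma words_extend:
  "w \<in> words Q n \<Longrightarrow> a \<in> Q \<Longrightarrow> w(n := a) \<in> words Q (Suc n)"
  by (auto simp: words_def PiE_iff extensional_def less_Suc_eq)

lemma sum_words_Suc:
  fixes f :: "(nat \<Rightarrow> 'a) \<Rightarrow> real"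
  shows "(\<Sum>w\<in>words Q (Suc n). f w) = (\<Sum>w\<in>words Q n. \<Sum>a\<in>Q. f (w(n := a)))"
proof -
  have "words Q (Suc n) = (\<lambda>(a, w). w(n := a)) ` (Q \<times> words Q n)"
    by (simp add: words_def lessThan_Suc PiE_insert_eq)
  moreover have "inj_on (\<lambda>(a, w). w(n := a)) (Q \<times> words Q n)"
    unfolding words_def by (rule inj_combinator) simp
  ultimately have "(\<Sum>w\<in>words Q (Suc n). f w) = (\<Sum>a\<in>Q. \<Sum>w\<in>words Q n. f (w(n := a)))"
    by (simp add: sum.reindex sum.cartesian_product case_prod_unfold)
  then show ?thesis by (simp only: sum.swap[of _ "words Q n" Q])
qed

lemma zero_line_sums_slice:
  assumes "zero_line_sums Q (Suc n) F" "a \<in> Q"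
  shows "zero_line_sums Q n (\<lambda>w. F (w(n := a)))"
  unfolding zero_line_sums_def
proof (intro ballI allI impI)
  fix w i assume w: "w \<in> words Q n" and i: "i < n"
  have "(\<Sum>x\<in>Q. F ((w(n := a))(i := x))) = 0"
    using assms words_extend[OF w assms(2)] i unfolding zero_line_sums_def by simp
  then show "(\<Sum>x\<in>Q. F ((w(i := x))(n := a))) = 0"
    using i by (simp add: fun_upd_twist)
qed

lemma zero_line_sums_add:
  "zero_line_sums Q n F \<Longrightarrow> zero_line_sums Q n G \<Longrightarrow> zero_line_sums Q n (\<lambda>w. F w + G w)"
  by (simp add: zero_line_sums_def sum.distrib)

lemma zero_line_sums_scale:
  "zero_line_sums Q n F \<Longrightarrow> zero_line_sums Q n (\<lambda>w. k * F w)"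
  by (simp add: zero_line_sums_def sum_distrib_left[symmetric])

lemma vertex_Suc:
  "n \<notin> T \<Longrightarrow> vertex p q (Suc n) T = (vertex p q n T)(n := p)"
  "n \<notin> T \<Longrightarrow> vertex p q (Suc n) (insert n T) = (vertex p q n T)(n := q)"
  by (auto simp: vertex_def fun_eq_iff)

section \<open>The energy identity\<close>

text \<open>Parseval's identity, by induction on the last coordinate. On a line with values x at
  \<open>p\<close> and y at \<open>q\<close> the third value is -(x + y), and completing the square
  gives x^2 + y^2 + (x + y)^2 = 3/2 x^2 + 2 (y + x/2)^2.\<close>

lemma sum_squares_gs_coeff:
  fixes F :: "(nat \<Rightarrow> 'a) \<Rightarrow> real"
  assumes Q: "Q = {p, q, r}" "p \<noteq> q" "q \<noteq> r" "p \<noteq> r"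
    and "zero_line_sums Q n F"
  shows "(\<Sum>w\<in>words Q n. (F w)\<^sup>2)
    = (\<Sum>S\<in>Pow {..<n}. (3/2) ^ n * (4/3) ^ card S * (gs_coeff (\<lambda>T. F (vertex p q n T)) S)\<^sup>2)"
  using assms(5)
proof (induction n arbitrary: F)
  case 0
  show ?case
    by (simp add: words_def gs_coeff_def vertex_def)
next
  case (Suc n)
  \<comment> \<open>\<open>P\<close> and \<open>R\<close> are the coordinates along the two
    orthogonal vectors, of squared norms 3/2 and 2. \<open>P\<close> will account for the sets
    without \<open>n\<close>, \<open>R\<close> for those containing \<open>n\<close>.\<close>
  define P where "P = (\<lambda>w. F (w(n := p)))"
  define R where "R = (\<lambda>w. F (w(n := q)) + 1/2 * F (w(n := p)))"
  define c where "c = (\<lambda>T. F (vertex p q (Suc n) T))"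
  have zP: "zero_line_sums Q n P"
    unfolding P_def using Suc.prems by (rule zero_line_sums_slice) (simp add: Q)
  have "zero_line_sums Q n (\<lambda>w. F (w(n := q)))"
    using Suc.prems by (rule zero_line_sums_slice) (simp add: Q)
  then have zR: "zero_line_sums Q n R"
    unfolding R_def using zero_line_sums_scale[OF zP[unfolded P_def], of "1/2"]
    by (rule zero_line_sums_add)
  have "(\<Sum>a\<in>Q. (F (w(n := a)))\<^sup>2) = 3/2 * (P w)\<^sup>2 + 2 * (R w)\<^sup>2" if "w \<in> words Q n" for w
  proof -
    have "(\<Sum>x\<in>Q. F ((w(n := p))(n := x))) = 0"
      using Suc.prems words_extend[OF that, of p] Q(1) unfolding zero_line_sums_def by blast
    then have r: "F (w(n := r)) = - (F (w(n := p)) + F (w(n := q)))"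
      using Q by simp
    have "(\<Sum>a\<in>Q. (F (w(n := a)))\<^sup>2)
        = (F (w(n := p)))\<^sup>2 + (F (w(n := q)))\<^sup>2 + (F (w(n := r)))\<^sup>2"
      using Q by simp
    then show ?thesis
      unfolding r P_def R_def by (simp add: power2_eq_square algebra_simps)
  qed
  then have "(\<Sum>w\<in>words Q (Suc n). (F w)\<^sup>2)
      = 3/2 * (\<Sum>w\<in>words Q n. (P w)\<^sup>2) + 2 * (\<Sum>w\<in>words Q n. (R w)\<^sup>2)"
    by (simp add: sum_words_Suc sum.distrib sum_distrib_left)
  moreover have "gs_coeff (\<lambda>T. P (vertex p q n T)) S = gs_coeff c S"
      and "gs_coeff (\<lambda>T. R (vertex p q n T)) S = gs_coeff c (insert n S)"
    if "S \<in> Pow {..<n}" for S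
  proof -
    have n: "n \<notin> T" if "T \<subseteq> S" for T
      using that \<open>S \<in> Pow {..<n}\<close> by auto
    show P: "gs_coeff (\<lambda>T. P (vertex p q n T)) S = gs_coeff c S"
      by (rule gs_coeff_cong) (simp add: P_def c_def vertex_Suc n)
    have "gs_coeff (\<lambda>T. F ((vertex p q n T)(n := q))) S = gs_coeff (\<lambda>T. c (insert n T)) S"
      by (rule gs_coeff_cong) (simp add: c_def vertex_Suc n)
    moreover have "finite S"
      using that finite_subset by auto
    ultimately show "gs_coeff (\<lambda>T. R (vertex p q n T)) S = gs_coeff c (insert n S)"
      using P n[of S] by (simp add: R_def P_def gs_coeff_add gs_coeff_scale[of "1/2", simplified] gs_coeff_insert)
  qed
  \<comment> \<open>Adjoining \<open>n\<close> to \<open>S\<close> contributes 3/2 * 4/3 = 2, the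
    squared norm that goes with \<open>R\<close>.\<close>
  moreover have "(\<Sum>S\<in>Pow {..<n}. (3/2) ^ Suc n * (4/3) ^ card (insert n S) * (gs_coeff c (insert n S))\<^sup>2)
      = 2 * (\<Sum>S\<in>Pow {..<n}. (3/2) ^ n * (4/3) ^ card S * (gs_coeff c (insert n S))\<^sup>2)"
    unfolding sum_distrib_left
  proof (intro sum.cong refl)
    fix S assume "S \<in> Pow {..<n}"
    then have "finite S" "n \<notin> S" using finite_subset by auto
    then show "(3/2) ^ Suc n * (4/3) ^ card (insert n S) * (gs_coeff c (insert n S))\<^sup>2
        = 2 * ((3/2) ^ n * (4/3) ^ card S * (gs_coeff c (insert n S))\<^sup>2)"
      by simp
  qed
  moreover have "(\<Sum>S\<in>Pow {..<n}. (3/2) ^ Suc n * (4/3) ^ card S * (gs_coeff c S)\<^sup>2)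
      = 3/2 * (\<Sum>S\<in>Pow {..<n}. (3/2) ^ n * (4/3) ^ card S * (gs_coeff c S)\<^sup>2)"
    by (simp add: sum_distrib_left mult.assoc)
  ultimately show ?case
    unfolding c_def[symmetric] lessThan_Suc Suc.IH[OF zP] Suc.IH[OF zR]
    by (simp add: sum_Pow_insert del: power_Suc)
qed

text \<open>All coefficients of the difference vanish, so by the energy identity its sum of squares
  is 0.\<close>

lemma zero_line_sums_eqI:
  assumes Q: "Q = {p, q, r}" "p \<noteq> q" "q \<noteq> r" "p \<noteq> r"
    and F: "zero_line_sums Q n F" and G: "zero_line_sums Q n G"
    and eq: "\<And>T. T \<subseteq> {..<n} \<Longrightarrow> F (vertex p q n T) = G (vertex p q n T)"
    and w: "w \<in> words Q n"
  shows "F w = G w"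
proof -
  let ?D = "\<lambda>w. F w + (-1) * G w"
  have "zero_line_sums Q n ?D"
    using F G by (intro zero_line_sums_add zero_line_sums_scale)
  moreover have "gs_coeff (\<lambda>T. ?D (vertex p q n T)) S = 0" if "S \<in> Pow {..<n}" for S
    unfolding gs_coeff_def using that eq by (intro sum.neutral ballI) (simp add: subset_trans)
  ultimately have "(\<Sum>w\<in>words Q n. (?D w)\<^sup>2) = 0"
    by (simp add: sum_squares_gs_coeff[OF Q])
  moreover have "finite (words Q n)"
    using Q by (simp add: words_def finite_PiE)
  ultimately have "(?D w)\<^sup>2 = 0"
    using w by (simp add: sum_nonneg_eq_0_iff)
  then show ?thesis by simp
qed

section \<open>Signed bitrades\<close>

text \<open>The value condition covers all functions, not just words, so that it applies to a
  \<open>vertex\<close> without a membership proof.\<close>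

definition signed_bitrade :: "'a set \<Rightarrow> nat \<Rightarrow> ((nat \<Rightarrow> 'a) \<Rightarrow> real) \<Rightarrow> bool" where
  "signed_bitrade Q n F \<longleftrightarrow> range F \<subseteq> {-1, 0, 1} \<and> zero_line_sums Q n F"

text \<open>Give one colour class the sign 1 and the other -1. Two words of \<open>U\<close> on a
  common line are adjacent, so they have opposite colours and their signs cancel.\<close>

lemma bitrade_signing:
  assumes Q: "finite Q" and U: "bitrade Q n U"
  obtains F where "signed_bitrade Q n F" "U = {w \<in> words Q n. F w \<noteq> 0}"
proof -
  obtain A B where AB: "A \<union> B = U" "A \<inter> B = {}"
      and edge: "\<And>e. e \<in> induced_edges (hamming_edges Q n) U \<Longrightarrow> \<exists>a\<in>A. \<exists>b\<in>B. e = {a, b}"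
    using U unfolding bitrade_def bipartite_def by metis
  have Uw: "U \<subseteq> words Q n"
    using U by (simp add: bitrade_def unitrade_def)
  define F :: "(nat \<Rightarrow> 'a) \<Rightarrow> real" where "F = (\<lambda>w. if w \<in> A then 1 else if w \<in> B then -1 else 0)"
  have F0: "F w \<noteq> 0 \<longleftrightarrow> w \<in> U" for w
    using AB by (auto simp: F_def)
  have "(\<Sum>x\<in>Q. F (w(i := x))) = 0" if w: "w \<in> words Q n" and i: "i < n" for w i
  proof -
    let ?L = "{v \<in> words Q n. \<forall>j<n. j \<noteq> i \<longrightarrow> v j = w j}"
    \<comment> \<open>The face is parametrised by its free coordinate; from \<open>n\<close> on both
      words are \<open>undefined\<close>.\<close>
    have L: "?L = (\<lambda>x. w(i := x)) ` Q"
    proof (intro equalityI subsetI)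
      fix v assume v: "v \<in> ?L"
      have "v j = (w(i := v i)) j" for j
        using v w by (cases "j < n") (auto simp: words_def PiE_iff extensional_def)
      then have "v = w(i := v i)" by blast
      moreover have "v i \<in> Q" using v i by (auto simp: words_def PiE_iff)
      ultimately show "v \<in> (\<lambda>x. w(i := x)) ` Q" by blast
    qed (use w i in \<open>auto intro: words_fun_upd\<close>)
    have inj: "inj_on (\<lambda>x. w(i := x)) Q"
      by (auto simp: inj_on_def dest: fun_upd_eqD)
    have fin: "finite ?L" unfolding L using Q by simp
    have "(\<Sum>x\<in>Q. F (w(i := x))) = (\<Sum>v\<in>?L. F v)"
      unfolding L using inj by (simp add: sum.reindex)
    also have "\<dots> = (\<Sum>v\<in>U \<inter> ?L. F v)"
      using fin F0 by (intro sum.mono_neutral_right) auto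
    also have "\<dots> = 0"
    proof -
      have "?L \<in> one_dim_faces Q n"
        unfolding one_dim_faces_def using w i by blast
      then consider "card (U \<inter> ?L) = 0" | "card (U \<inter> ?L) = 2"
        using U unfolding bitrade_def unitrade_def by meson
      then show ?thesis
      proof cases
        case 1
        then have "U \<inter> ?L = {}" using fin by simp
        then show ?thesis by (simp only: sum.empty)
      next
        case 2
        then obtain u v where uv: "U \<inter> ?L = {u, v}" "u \<noteq> v"
          by (auto simp: card_2_iff)
        then have mem: "u \<in> U \<inter> ?L" "v \<in> U \<inter> ?L" by simp_all
        then obtain x y where xy: "u = w(i := x)" "v = w(i := y)"
          unfolding L by (elim IntE imageE)
        have "x \<noteq> y" using xy uv by blast
        then have "{j. j < n \<and> u j \<noteq> v j} = {i}"
          using i xy by auto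
        then have "card {j. j < n \<and> u j \<noteq> v j} = 1" by simp
        then have "{u, v} \<in> induced_edges (hamming_edges Q n) U"
          unfolding induced_edges_def hamming_edges_def using mem by auto
        then obtain a b where ab: "a \<in> A" "b \<in> B" "{u, v} = {a, b}"
          using edge by blast
        \<comment> \<open>\<open>F\<close> tests \<open>A\<close> first, so the value -1 at
          \<open>b\<close> requires that \<open>b\<close> lie outside \<open>A\<close>.\<close>
        then have "a \<noteq> b" "b \<notin> A" using AB(2) by auto
        then show ?thesis
          unfolding uv(1) ab(3) using ab(1,2) by (simp add: F_def)
      qed
    qed
    finally show ?thesis .
  qed
  then have "signed_bitrade Q n F"
    by (auto simp: signed_bitrade_def zero_line_sums_def F_def)
  moreover have "U = {w \<in> words Q n. F w \<noteq> 0}"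
    using F0 Uw by auto
  ultimately show thesis by (rule that)
qed

text \<open>Vertices whose value is not recovered by rounding from those of the smaller vertices;
  the small sets are included because their weight \<open>(3/2)^n (4/3)^|S|\<close> is too low for
  the energy bound to say anything about them.\<close>

definition unrounded :: "'a \<Rightarrow> 'a \<Rightarrow> nat \<Rightarrow> ((nat \<Rightarrow> 'a) \<Rightarrow> real) \<Rightarrow> nat set set" where
  "unrounded p q n F =
     {S \<in> Pow {..<n}. 3 * card S < n \<or> 1/2 \<le> \<bar>gs_coeff (\<lambda>T. F (vertex p q n T)) S\<bar>}"

text \<open>Small sets are few by an exponential-weight count, large ones because each uses up a
  share of the energy, which is at most 3^n. The factor 5 is 1 for the small sets plus 4 for the
  large, the latter from \<mu>^2 \<ge> 1/4.\<close>

lemma card_unrounded: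
  assumes Q: "Q = {p, q, r}" "p \<noteq> q" "q \<noteq> r" "p \<noteq> r"
    and F: "signed_bitrade Q n F"
  shows "real (card (unrounded p q n F)) \<le> 5 * (189/100) ^ n"
proof -
  define \<mu> where "\<mu> = gs_coeff (\<lambda>T. F (vertex p q n T))"
  define X where "X = {S \<in> Pow {..<n}. 3 * card S < n}"
  define Y where "Y = {S \<in> Pow {..<n}. n \<le> 3 * card S \<and> 1/2 \<le> \<bar>\<mu> S\<bar>}"
  have XY: "unrounded p q n F \<subseteq> X \<union> Y"
    by (auto simp: unrounded_def X_def Y_def \<mu>_def)
  have fin: "finite X" "finite Y" by (simp_all add: X_def Y_def)

  have "real (card X) = (\<Sum>S\<in>X. 1)" by simp
  \<comment> \<open>Since 1.26^3 > 2, the condition 3|S| < n gives 2^|S| \<le> 1.26^n. The weighted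
    sum over all subsets then grows at rate 1.26 * 3/2 = 1.89.\<close>
  also have "\<dots> \<le> (\<Sum>S\<in>X. (126/100) ^ n * (1/2) ^ card S)"
  proof (rule sum_mono)
    fix S assume "S \<in> X"
    then have "(126/100::real) ^ (3 * card S) \<le> (126/100) ^ n"
      by (intro power_increasing) (auto simp: X_def)
    moreover have "(2::real) ^ card S \<le> ((126/100) ^ 3) ^ card S"
      by (intro power_mono) (auto simp: power3_eq_cube)
    ultimately have "(2::real) ^ card S \<le> (126/100) ^ n" by (simp only: power_mult)
    then show "1 \<le> (126/100::real) ^ n * (1/2) ^ card S"
      by (simp add: power_one_over field_simps)
  qed
  also have "\<dots> \<le> (\<Sum>S\<in>Pow {..<n}. (126/100) ^ n * (1/2) ^ card S)"
    by (intro sum_mono2) (auto simp: X_def)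
  also have "\<dots> = (126/100) ^ n * (3/2) ^ n"
    by (simp add: sum_distrib_left[symmetric] sum_Pow_power_card)
  also have "\<dots> = (189/100) ^ n"
    by (simp flip: power_mult_distrib)
  finally have X: "real (card X) \<le> (189/100) ^ n" .

  \<comment> \<open>For n \<le> 3|S| the weight is at least 1.65^n, because 1.1^3 \<le> 4/3 and 3/2
    * 1.1 = 1.65.\<close>
  have "(165/100) ^ n * (real (card Y) / 4) = (\<Sum>S\<in>Y. (165/100) ^ n * (1/4))"
    by simp
  also have "\<dots> \<le> (\<Sum>S\<in>Y. (3/2) ^ n * (4/3) ^ card S * (\<mu> S)\<^sup>2)"
  proof (rule sum_mono)
    fix S assume S: "S \<in> Y"
    then have "(11/10::real) ^ n \<le> (11/10) ^ (3 * card S)"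
      by (intro power_increasing) (auto simp: Y_def)
    moreover have "((11/10) ^ 3) ^ card S \<le> (4/3::real) ^ card S"
      by (intro power_mono) (auto simp: power3_eq_cube)
    ultimately have "(11/10::real) ^ n \<le> (4/3) ^ card S" by (simp only: power_mult)
    moreover have "(165/100::real) ^ n = (3/2) ^ n * (11/10) ^ n"
      by (simp flip: power_mult_distrib)
    ultimately have "(165/100::real) ^ n \<le> (3/2) ^ n * (4/3) ^ card S" by simp
    moreover have "1/4 \<le> (\<mu> S)\<^sup>2"
      using power_mono[of "1/2" "\<bar>\<mu> S\<bar>" 2] S by (simp add: Y_def power_divide)
    ultimately show "(165/100) ^ n * (1/4) \<le> (3/2) ^ n * (4/3) ^ card S * (\<mu> S)\<^sup>2"
      by (intro mult_mono) auto
  qed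
  also have "\<dots> \<le> (\<Sum>S\<in>Pow {..<n}. (3/2) ^ n * (4/3) ^ card S * (\<mu> S)\<^sup>2)"
    by (intro sum_mono2) (auto simp: Y_def)
  also have "\<dots> = (\<Sum>w\<in>words Q n. (F w)\<^sup>2)"
    using sum_squares_gs_coeff[OF Q, of n F] F by (simp add: signed_bitrade_def \<mu>_def)
  also have "\<dots> \<le> (\<Sum>w\<in>words Q n. 1)"
  proof (rule sum_mono)
    fix w
    have "F w \<in> {-1, 0, 1}" using F by (auto simp: signed_bitrade_def)
    then show "(F w)\<^sup>2 \<le> 1" by auto
  qed
  also have "\<dots> = 3 ^ n"
    using Q by (simp add: words_def card_PiE)
  \<comment> \<open>Here 1.65 * 1.89 = 3.1185, so both kinds of sets obey the same rate
    1.89.\<close>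
  also have "\<dots> \<le> ((165/100) * (189/100)) ^ n"
    by (intro power_mono) auto
  finally have "real (card Y) / 4 \<le> (189/100) ^ n"
    by (simp only: power_mult_distrib) simp
  moreover have "real (card (unrounded p q n F)) \<le> real (card X) + real (card Y)"
    using card_mono[OF _ XY] card_Un_le[of X Y] fin by (simp flip: of_nat_add)
  ultimately show ?thesis using X by simp
qed

text \<open>Induction over proper subsets: where both coefficients are below 1/2 in absolute value
  and all smaller values agree, the two values at \<open>S\<close> are integers less than 1
  apart.\<close>

lemma signed_bitrade_determined:
  assumes F: "signed_bitrade Q n F" and G: "signed_bitrade Q n G"
    and un: "unrounded p q n F = unrounded p q n G"
    and eq: "\<And>T. T \<in> unrounded p q n F \<Longrightarrow> F (vertex p q n T) = G (vertex p q n T)"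
    and S: "S \<subseteq> {..<n}"
  shows "F (vertex p q n S) = G (vertex p q n S)"
proof -
  have "finite S" using S finite_subset by blast
  then show ?thesis using S
  proof (induction S rule: finite_psubset_induct)
    case (psubset S)
    let ?f = "\<lambda>T. F (vertex p q n T)" and ?g = "\<lambda>T. G (vertex p q n T)"
    show ?case
    proof (cases "S \<in> unrounded p q n F")
      case False
      then have small: "\<bar>gs_coeff ?f S\<bar> < 1/2" "\<bar>gs_coeff ?g S\<bar> < 1/2"
        using psubset.prems un unfolding unrounded_def by auto
      \<comment> \<open>The term of \<open>S\<close> itself has weight 1; the remaining terms cancel
        between \<open>F\<close> and \<open>G\<close> by the induction hypothesis.\<close>
      have split: "gs_coeff c S = c S + (\<Sum>T\<in>Pow S - {S}. (1/2) ^ card (S - T) * c T)" for c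
        unfolding gs_coeff_def using psubset.hyps by (subst sum.remove[of _ S]) auto
      have "?f T = ?g T" if "T \<in> Pow S - {S}" for T
        using that psubset.IH[of T] psubset.prems by auto
      then have "gs_coeff ?f S - gs_coeff ?g S = ?f S - ?g S"
        unfolding split[of ?f] split[of ?g] by simp
      then have "\<bar>?f S - ?g S\<bar> < 1" using small by linarith
      moreover have "?f S \<in> {-1, 0, 1}" "?g S \<in> {-1, 0, 1}"
        using F G unfolding signed_bitrade_def by blast+
      ultimately show ?thesis by auto
    qed (rule eq)
  qed
qed

section \<open>Counting\<close>

lemma card_bounded_subsets:
  assumes "finite M"
  shows "card {Z. Z \<subseteq> M \<and> card Z \<le> k} \<le> (card M + 1) ^ k"
proof -
  let ?L = "{xs. set xs \<subseteq> insert None (Some ` M) \<and> length xs = k}"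
  let ?f = "\<lambda>xs. {x. Some x \<in> set xs}"
  have "{Z. Z \<subseteq> M \<and> card Z \<le> k} \<subseteq> ?f ` ?L"
  proof
    fix Z assume Z: "Z \<in> {Z. Z \<subseteq> M \<and> card Z \<le> k}"
    then have "finite Z" using assms finite_subset by blast
    then obtain zs where zs: "set zs = Z" "distinct zs"
      using finite_distinct_list by blast
    let ?xs = "map Some zs @ replicate (k - card Z) None"
    have "?xs \<in> ?L"
      using Z zs distinct_card[OF zs(2)] by auto
    moreover have "Z = ?f ?xs" using zs by auto
    ultimately show "Z \<in> ?f ` ?L" by blast
  qed
  moreover have fin: "finite (insert None (Some ` M))" using assms by simp
  ultimately have "card {Z. Z \<subseteq> M \<and> card Z \<le> k} \<le> card ?L"
    using finite_lists_length_eq[OF fin] by (meson card_image_le card_mono finite_imageI le_trans)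
  also have "\<dots> = (card M + 1) ^ k"
    using card_lists_length_eq[OF fin] assms by (simp add: card_image)
  finally show ?thesis .
qed

text \<open>A bitrade is encoded by the graph of one chosen signing, restricted to the unrounded
  sets.\<close>

lemma card_bitrades_le:
  fixes Q :: "'a set"
  assumes "card Q = 3"
  shows "card {U. bitrade Q n U} \<le> (3 * 2 ^ n + 1) ^ nat \<lfloor>5 * (189/100::real) ^ n\<rfloor>"
proof -
  obtain p q r where Q: "Q = {p, q, r}" "p \<noteq> q" "q \<noteq> r" "p \<noteq> r"
    using assms by (auto simp: card_3_iff)
  have "\<exists>F. signed_bitrade Q n F \<and> U = {w \<in> words Q n. F w \<noteq> 0}" if "bitrade Q n U" for U
    using bitrade_signing[OF _ that] Q by blast
  then obtain F where F: "\<And>U. bitrade Q n U \<Longrightarrow> signed_bitrade Q n (F U)"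
      and supp: "\<And>U. bitrade Q n U \<Longrightarrow> U = {w \<in> words Q n. F U w \<noteq> 0}"
    by metis
  define M :: "(nat set \<times> real) set" where "M = Pow {..<n} \<times> {-1, 0, 1}"
  define k where "k = nat \<lfloor>5 * (189/100::real) ^ n\<rfloor>"
  \<comment> \<open>Storing \<open>T\<close> along with the value lets the code reveal the
    collection of unrounded sets itself, which the recovery of the values presupposes.\<close>
  define Z where "Z = (\<lambda>U. (\<lambda>T. (T, F U (vertex p q n T))) ` unrounded p q n (F U))"
  have "inj_on Z {U. bitrade Q n U}"
  proof (rule inj_onI, clarify)
    fix U V assume U: "bitrade Q n U" and V: "bitrade Q n V" and ZZ: "Z U = Z V"
    have "fst ` Z U = unrounded p q n (F U)" for U
      by (simp add: Z_def image_image)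
    then have un: "unrounded p q n (F U) = unrounded p q n (F V)"
      using ZZ by metis
    have eq: "F U (vertex p q n T) = F V (vertex p q n T)" if "T \<in> unrounded p q n (F U)" for T
    proof -
      have "(T, F U (vertex p q n T)) \<in> Z U"
        using that by (simp add: Z_def)
      then have "(T, F U (vertex p q n T)) \<in> Z V"
        by (simp only: ZZ)
      then show ?thesis by (auto simp: Z_def)
    qed
    have "zero_line_sums Q n (F U)" "zero_line_sums Q n (F V)"
      using F[OF U] F[OF V] by (simp_all add: signed_bitrade_def)
    \<comment> \<open>The code fixes the values at the vertices, these fix the signing on all words,
      and its support is the bitrade.\<close>
    then have "F U w = F V w" if "w \<in> words Q n" for w
      using signed_bitrade_determined[OF F[OF U] F[OF V] un eq] that
      by (rule zero_line_sums_eqI[OF Q])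
    then have "{w \<in> words Q n. F U w \<noteq> 0} = {w \<in> words Q n. F V w \<noteq> 0}" by auto
    then show "U = V" using supp[OF U] supp[OF V] by simp
  qed
  moreover have "Z ` {U. bitrade Q n U} \<subseteq> {Z. Z \<subseteq> M \<and> card Z \<le> k}"
  proof clarify
    fix U assume U: "bitrade Q n U"
    have "Z U \<subseteq> M"
      using F[OF U] by (auto simp: Z_def M_def unrounded_def signed_bitrade_def)
    moreover have "finite (unrounded p q n (F U))" by (simp add: unrounded_def)
    then have "card (Z U) \<le> card (unrounded p q n (F U))"
      unfolding Z_def by (rule card_image_le)
    moreover have "card (unrounded p q n (F U)) \<le> k"
      using card_unrounded[OF Q F[OF U]] by (simp add: k_def le_nat_floor)
    ultimately show "Z U \<subseteq> M \<and> card (Z U) \<le> k" by simp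
  qed
  moreover have "finite M" by (simp add: M_def)
  ultimately have "card {U. bitrade Q n U} \<le> card {Z. Z \<subseteq> M \<and> card Z \<le> k}"
    by (intro card_inj_on_le) (auto intro: finite_subset[of _ "Pow M"])
  also have "\<dots> \<le> (card M + 1) ^ k"
    using \<open>finite M\<close> by (rule card_bounded_subsets)
  also have "card M = 3 * 2 ^ n"
    by (simp add: M_def card_cartesian_product card_Pow)
  finally show ?thesis unfolding k_def .
qed

theorem mainTheorem6:
  fixes Q :: "'a set"
  assumes "card Q = 3"
  shows "\<exists>\<alpha>\<^sub>1::real. \<alpha>\<^sub>1 < 2 \<and>
    (\<exists>N::nat. \<forall>n\<ge>N. real (card {U. bitrade Q n U}) \<le> 2 powr (\<alpha>\<^sub>1 ^ n))"
proof -
  \<comment> \<open>The factor \<open>n + 2\<close> comes from 3 * 2^n + 1 \<le> 2^(n+2). Any base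
    strictly between 1.89 and 2 absorbs it together with the 5; the choice is 1.9.\<close>
  have "eventually (\<lambda>n::nat. (real n + 2) * (5 * (189/100) ^ n) \<le> (19/10) ^ n) sequentially"
    by real_asymp
  then obtain N where N: "\<And>n. n \<ge> N \<Longrightarrow> (real n + 2) * (5 * (189/100) ^ n) \<le> (19/10) ^ n"
    by (auto simp: eventually_sequentially)
  have "real (card {U. bitrade Q n U}) \<le> 2 powr ((19/10) ^ n)" if "n \<ge> N" for n
  proof -
    define k where "k = nat \<lfloor>5 * (189/100::real) ^ n\<rfloor>"
    have k: "real k \<le> 5 * (189/100) ^ n" by (simp add: k_def)
    have "card {U. bitrade Q n U} \<le> (3 * 2 ^ n + 1) ^ k"
      unfolding k_def by (rule card_bitrades_le[OF assms])
    also have "\<dots> \<le> (2 ^ (n + 2)) ^ k"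
      by (intro power_mono) auto
    finally have "real (card {U. bitrade Q n U}) \<le> real ((2 ^ (n + 2)) ^ k)"
      by (rule of_nat_mono)
    also have "\<dots> = 2 powr ((real n + 2) * real k)"
    proof -
      have "real ((2 ^ (n + 2)) ^ k) = 2 ^ ((n + 2) * k)"
        by (simp only: of_nat_power of_nat_numeral power_mult)
      also have "\<dots> = 2 powr real ((n + 2) * k)"
        by (rule powr_realpow[symmetric]) simp
      finally show ?thesis by (simp only: of_nat_mult of_nat_add of_nat_numeral)
    qed
    also have "\<dots> \<le> 2 powr ((19/10) ^ n)"
    proof (rule powr_mono)
      have "(real n + 2) * real k \<le> (real n + 2) * (5 * (189/100) ^ n)"
        using k by (intro mult_left_mono) auto
      also have "\<dots> \<le> (19/10) ^ n" using N[OF that] .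
      finally show "(real n + 2) * real k \<le> (19/10) ^ n" .
    qed simp
    finally show ?thesis .
  qed
  then show ?thesis by (intro exI[of _ "19/10"]) auto
qed

end
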